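(* Let $J$ be an open arc in a Riemann surface $X$. Then $J$ is a regular analytic open arc if and only if $J$ is a conformal open arc.
   Context: Let $I=\{t\in\mathbb{R}:0<t<1\}$. An open arc $J$ in a topological space $X$ is a subset $J\subset X$ (with the relative topology) which is a homeomorphic image of $I$; a homeomorphism $\varphi:I\rightarrow J$ is called a parametrization of $J$. An open arc $J$ in a Riemann surface $X$ is an analytic open arc if it has a parametrization $\varphi:I\rightarrow J$ which is analytic, that is, for every $t_0\in I$ and every local coordinate $z$ in a neighborhood of $\varphi(t_0)$, the function $z\circ\varphi$ has a representation as a power series $(z\circ\varphi)(t)=\sum_j a_j(t-t_0)^j$ near $t_0$. It is a regular analytic open arc if there is such an analytic parametrization with $\varphi^\prime(t)\neq0$ (computed in local coordinates) for all $t\in I$. An open arc $J$ in a Riemann surface $X$ is a conformal open arc if it has a parametrization $\varphi:I\rightarrow J$ which extends to a one-to-one conformal (injective holomorphic) mapping from a neighborhood of $I$ in $\mathbb{C}$ into $X$. *)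

theory Defs
  imports "HOL-Complex_Analysis.Complex_Analysis"
begin

definition unit_interval :: "real set" where
  "unit_interval = {0<..<1}"

section \<open>Riemann surfaces\<close>

definition complex_chart :: "'a topology \<Rightarrow> 'a set \<Rightarrow> ('a \<Rightarrow> complex) \<Rightarrow> bool" where
  "complex_chart X U z \<longleftrightarrow>
     openin X U \<and> open (z ` U) \<and>
     homeomorphic_map (subtopology X U) (top_of_set (z ` U)) z"

definition holo_compatible ::
    "'a set \<Rightarrow> ('a \<Rightarrow> complex) \<Rightarrow> 'a set \<Rightarrow> ('a \<Rightarrow> complex) \<Rightarrow> bool" where
  "holo_compatible U z V w \<longleftrightarrow>
     (w \<circ> inv_into U z) holomorphic_on z ` (U \<inter> V) \<and>
     (z \<circ> inv_into V w) holomorphic_on w ` (U \<inter> V)"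

text \<open>
  The atlas need not be maximal: the local coordinates below are the members of
  the maximal atlas that it generates. Second countability is not required, as
  it follows from the other conditions (Rado's theorem).
\<close>

definition riemann_surface ::
    "'a topology \<Rightarrow> ('a set \<times> ('a \<Rightarrow> complex)) set \<Rightarrow> bool" where
  "riemann_surface X \<A> \<longleftrightarrow>
     Hausdorff_space X \<and> connected_space X \<and>
     (\<forall>(U, z)\<in>\<A>. complex_chart X U z) \<and>
     (\<Union>(U, z)\<in>\<A>. U) = topspace X \<and>
     (\<forall>(U, z)\<in>\<A>. \<forall>(V, w)\<in>\<A>. holo_compatible U z V w)"

definition local_coordinate ::
    "'a topology \<Rightarrow> ('a set \<times> ('a \<Rightarrow> complex)) set \<Rightarrow> 'a set \<Rightarrow> ('a \<Rightarrow> complex) \<Rightarrow> bool" where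
  "local_coordinate X \<A> U z \<longleftrightarrow>
     complex_chart X U z \<and> (\<forall>(V, w)\<in>\<A>. holo_compatible U z V w)"

lemma atlas_local_coordinate:
  assumes "riemann_surface X \<A>" and "(U, z) \<in> \<A>"
  shows "local_coordinate X \<A> U z"
proof -
  have "\<forall>(U, z)\<in>\<A>. complex_chart X U z"
    and "\<forall>(U, z)\<in>\<A>. \<forall>(V, w)\<in>\<A>. holo_compatible U z V w"
    using assms(1) by (simp_all add: riemann_surface_def)
  from this[THEN bspec, OF assms(2)] show ?thesis
    by (simp add: local_coordinate_def)
qed

definition holomorphic_into ::
    "'a topology \<Rightarrow> ('a set \<times> ('a \<Rightarrow> complex)) set \<Rightarrow> complex set \<Rightarrow> (complex \<Rightarrow> 'a) \<Rightarrow> bool" where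
  "holomorphic_into X \<A> \<Omega> \<Phi> \<longleftrightarrow>
     continuous_map (top_of_set \<Omega>) X \<Phi> \<and>
     (\<forall>U z. local_coordinate X \<A> U z \<longrightarrow> (z \<circ> \<Phi>) holomorphic_on {s \<in> \<Omega>. \<Phi> s \<in> U})"

section \<open>Open arcs\<close>

definition arc_parametrization :: "'a topology \<Rightarrow> 'a set \<Rightarrow> (real \<Rightarrow> 'a) \<Rightarrow> bool" where
  "arc_parametrization X J \<phi> \<longleftrightarrow>
     homeomorphic_map (top_of_set unit_interval) (subtopology X J) \<phi>"

definition open_arc :: "'a topology \<Rightarrow> 'a set \<Rightarrow> bool" where
  "open_arc X J \<longleftrightarrow> J \<subseteq> topspace X \<and> (\<exists>\<phi>. arc_parametrization X J \<phi>)"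

text \<open>
  The values of a coordinate outside its domain are meaningless, hence the
  condition that the curve lies in \<open>U\<close> near \<open>t0\<close>; for a continuous
  curve it holds automatically.
\<close>

definition analytic_param ::
    "'a topology \<Rightarrow> ('a set \<times> ('a \<Rightarrow> complex)) set \<Rightarrow> (real \<Rightarrow> 'a) \<Rightarrow> bool" where
  "analytic_param X \<A> \<phi> \<longleftrightarrow>
     (\<forall>t0\<in>unit_interval. \<forall>U z. local_coordinate X \<A> U z \<and> \<phi> t0 \<in> U \<longrightarrow>
        (\<exists>a :: nat \<Rightarrow> complex. \<forall>\<^sub>F t in nhds t0.
            \<phi> t \<in> U \<and> (\<lambda>j. a j * of_real (t - t0) ^ j) sums (z \<circ> \<phi>) t))"

definition nonvanishing_derivative ::
    "'a topology \<Rightarrow> ('a set \<times> ('a \<Rightarrow> complex)) set \<Rightarrow> (real \<Rightarrow> 'a) \<Rightarrow> bool" where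
  "nonvanishing_derivative X \<A> \<phi> \<longleftrightarrow>
     (\<forall>t\<in>unit_interval. \<forall>U z. local_coordinate X \<A> U z \<and> \<phi> t \<in> U \<longrightarrow>
        (\<exists>D. ((z \<circ> \<phi>) has_vector_derivative D) (at t) \<and> D \<noteq> 0))"

definition analytic_open_arc ::
    "'a topology \<Rightarrow> ('a set \<times> ('a \<Rightarrow> complex)) set \<Rightarrow> 'a set \<Rightarrow> bool" where
  "analytic_open_arc X \<A> J \<longleftrightarrow> open_arc X J \<and>
     (\<exists>\<phi>. arc_parametrization X J \<phi> \<and> analytic_param X \<A> \<phi>)"

definition regular_analytic_open_arc ::
    "'a topology \<Rightarrow> ('a set \<times> ('a \<Rightarrow> complex)) set \<Rightarrow> 'a set \<Rightarrow> bool" where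
  "regular_analytic_open_arc X \<A> J \<longleftrightarrow> open_arc X J \<and>
     (\<exists>\<phi>. arc_parametrization X J \<phi> \<and> analytic_param X \<A> \<phi> \<and>
          nonvanishing_derivative X \<A> \<phi>)"

definition conformal_open_arc ::
    "'a topology \<Rightarrow> ('a set \<times> ('a \<Rightarrow> complex)) set \<Rightarrow> 'a set \<Rightarrow> bool" where
  "conformal_open_arc X \<A> J \<longleftrightarrow> open_arc X J \<and>
     (\<exists>\<phi>. arc_parametrization X J \<phi> \<and>
        (\<exists>\<Omega> \<Phi>. open \<Omega> \<and> of_real ` unit_interval \<subseteq> \<Omega> \<and>
           holomorphic_into X \<A> \<Omega> \<Phi> \<and> inj_on \<Phi> \<Omega> \<and>
           (\<forall>t\<in>unit_interval. \<Phi> (of_real t) = \<phi> t)))"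

end

theory Submission
  imports Defs
begin

text \<open>
  In a chart at \<open>\<phi> t\<close>, the power series of a regular analytic parametrization
  \<open>\<phi>\<close> extends it to an injective holomorphic map on a disc about \<open>t\<close>.
  Two such discs that meet also meet along a real interval, so the identity theorem glues the
  extensions to a holomorphic map on a neighbourhood of the interval. It is locally injective
  there, and its restriction to the interval is a homeomorphism onto the arc; this forces
  injectivity on a smaller neighbourhood, without a metric on the surface. Conversely, an
  injective holomorphic map has a nonvanishing derivative.
\<close>

section \<open>Holomorphic maps into a Riemann surface\<close>

lemma complex_chart_inj_on: "complex_chart X U z \<Longrightarrow> inj_on z U"
  by (metis complex_chart_def homeomorphic_imp_injective_map openin_subset topspace_subtopology_subset)

lemma complex_chart_continuous_inverse:
  assumes "complex_chart X U z"
  shows "continuous_map (top_of_set (z ` U)) X (inv_into U z)"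
proof -
  have U: "topspace (subtopology X U) = U"
    using assms by (metis complex_chart_def openin_subset topspace_subtopology_subset)
  obtain g where g: "homeomorphic_maps (subtopology X U) (top_of_set (z ` U)) z g"
    using assms by (auto simp: complex_chart_def homeomorphic_map_maps)
  have "continuous_map (top_of_set (z ` U)) X g"
    using g by (auto simp: homeomorphic_maps_def continuous_map_in_subtopology)
  moreover have "g w = inv_into U z w" if w: "w \<in> z ` U" for w
  proof -
    obtain u where u: "u \<in> U" "w = z u"
      using w by blast
    have "g (z u) = u"
      using g u U by (auto simp: homeomorphic_maps_def)
    then show ?thesis
      using u complex_chart_inj_on[OF assms] by simp
  qed
  ultimately show ?thesis
    by (auto intro: continuous_map_eq)
qed

lemma atlas_coordinate_at:
  assumes "riemann_surface X \<A>" "x \<in> topspace X"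
  obtains U z where "(U, z) \<in> \<A>" "x \<in> U" "complex_chart X U z" "local_coordinate X \<A> U z"
proof -
  have "x \<in> (\<Union>(U, z)\<in>\<A>. U)"
    using assms by (simp add: riemann_surface_def)
  then obtain U z where "(U, z) \<in> \<A>" "x \<in> U"
    by blast
  with that show thesis
    using atlas_local_coordinate[OF assms(1)] by (auto simp: local_coordinate_def)
qed

section \<open>Continuity, restriction and gluing of maps into the surface\<close>

lemma continuous_map_open_preimage:
  assumes "open S" "continuous_map (top_of_set S) X f" "openin X U"
  shows "open {s \<in> S. f s \<in> U}"
  using openin_continuous_map_preimage[OF assms(2,3)] assms(1)
  by (simp add: openin_open_eq)

lemma continuous_map_eventually_in:
  assumes "open S" "continuous_map (top_of_set S) X f" "openin X U" "s \<in> S" "f s \<in> U"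
  shows "\<forall>\<^sub>F w in nhds s. w \<in> S \<and> f w \<in> U"
  using eventually_nhds_in_open[OF continuous_map_open_preimage[OF assms(1-3)]] assms(4,5)
  by simp

lemma holomorphic_into_subset:
  assumes "holomorphic_into X \<A> S f" "T \<subseteq> S"
  shows "holomorphic_into X \<A> T f"
  unfolding holomorphic_into_def
proof (intro conjI allI impI)
  show "continuous_map (top_of_set T) X f"
    using assms continuous_map_from_subtopology_mono by (auto simp: holomorphic_into_def)
  fix U z
  assume "local_coordinate X \<A> U z"
  then have "(z \<circ> f) holomorphic_on {s \<in> S. f s \<in> U}"
    using assms by (simp add: holomorphic_into_def)
  then show "(z \<circ> f) holomorphic_on {s \<in> T. f s \<in> U}"
    by (rule holomorphic_on_subset) (use assms(2) in auto)
qed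

text \<open>Read in another local coordinate \<open>w\<close>, the map is the transition function
  \<open>w \<circ> inv_into U z\<close> after \<open>F\<close>. That transition function is
  holomorphic because a local coordinate is compatible with every member of the atlas, and
  \<open>(U, z)\<close> is such a member.\<close>

lemma holomorphic_into_inverse_chart:
  assumes UA: "(U, z) \<in> \<A>" and ch: "complex_chart X U z"
    and F: "F holomorphic_on S" "F ` S \<subseteq> z ` U"
  shows "holomorphic_into X \<A> S (inv_into U z \<circ> F)"
  unfolding holomorphic_into_def
proof (intro conjI allI impI)
  have "continuous_map (top_of_set S) (top_of_set (z ` U)) F"
    using F holomorphic_on_imp_continuous_on by (auto simp: continuous_map_in_subtopology)
  then show "continuous_map (top_of_set S) X (inv_into U z \<circ> F)"
    using complex_chart_continuous_inverse[OF ch] continuous_map_compose by blast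
next
  fix V w
  assume "local_coordinate X \<A> V w"
  then have "holo_compatible V w U z"
    using UA by (auto simp: local_coordinate_def)
  then have hol: "(w \<circ> inv_into U z) holomorphic_on z ` (V \<inter> U)"
    by (simp add: holo_compatible_def)
  let ?T = "{s \<in> S. (inv_into U z \<circ> F) s \<in> V}"
  \<comment> \<open>The transition function is known to be holomorphic on the image of the overlap
    only, so \<open>F\<close> has to land there.\<close>
  have "F ` ?T \<subseteq> z ` (V \<inter> U)"
  proof
    fix y
    assume "y \<in> F ` ?T"
    then obtain s where s: "s \<in> S" "inv_into U z (F s) \<in> V" "y = F s"
      by auto
    have "F s \<in> z ` U"
      using s F by auto
    then have "inv_into U z (F s) \<in> U" "z (inv_into U z (F s)) = F s"
      by (auto intro: inv_into_into f_inv_into_f)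
    with s show "y \<in> z ` (V \<inter> U)"
      by (metis IntI imageI)
  qed
  moreover have "F holomorphic_on ?T"
    using F(1) by (rule holomorphic_on_subset) auto
  ultimately have "((w \<circ> inv_into U z) \<circ> F) holomorphic_on ?T"
    using hol holomorphic_on_compose_gen by blast
  then show "(w \<circ> (inv_into U z \<circ> F)) holomorphic_on ?T"
    by (simp add: o_assoc)
qed

text \<open>Both requirements are local on open sets: continuity follows from the pasting lemma, and
  holomorphy in a coordinate is checked on each open piece
  \<open>{s \<in> D i. f i s \<in> U}\<close>.\<close>

lemma holomorphic_into_glue:
  assumes op: "\<And>i. i \<in> I \<Longrightarrow> open (D i)"
    and hol: "\<And>i. i \<in> I \<Longrightarrow> holomorphic_into X \<A> (D i) (f i)"
    and eq: "\<And>i s. i \<in> I \<Longrightarrow> s \<in> D i \<Longrightarrow> g s = f i s"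
  shows "holomorphic_into X \<A> (\<Union>i\<in>I. D i) g"
  unfolding holomorphic_into_def
proof (intro conjI allI impI)
  show "continuous_map (top_of_set (\<Union>i\<in>I. D i)) X g"
  proof (rule pasting_lemma[where I = I and T = D and f = f])
    fix i
    assume i: "i \<in> I"
    show "openin (top_of_set (\<Union>i\<in>I. D i)) (D i)"
      using i op by (auto intro: open_subset)
    have "(\<Union>i\<in>I. D i) \<inter> D i = D i"
      using i by auto
    then show "continuous_map (subtopology (top_of_set (\<Union>i\<in>I. D i)) (D i)) X (f i)"
      using hol[OF i] by (simp add: subtopology_subtopology holomorphic_into_def)
  next
    fix i j s
    assume "i \<in> I" "j \<in> I" "s \<in> topspace (top_of_set (\<Union>i\<in>I. D i)) \<inter> D i \<inter> D j"
    then show "f i s = f j s"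
      using eq[of i s] eq[of j s] by simp
  qed (use eq in auto)
next
  fix U z
  assume loc: "local_coordinate X \<A> U z"
  have "(z \<circ> g) holomorphic_on (\<Union>i\<in>I. {s \<in> D i. f i s \<in> U})"
  proof (rule holomorphic_on_UN_open)
    fix i
    assume i: "i \<in> I"
    have "(z \<circ> f i) holomorphic_on {s \<in> D i. f i s \<in> U}"
      using hol[OF i] loc by (auto simp: holomorphic_into_def)
    then show "(z \<circ> g) holomorphic_on {s \<in> D i. f i s \<in> U}"
      by (rule holomorphic_transform) (simp add: eq[OF i])
    show "open {s \<in> D i. f i s \<in> U}"
      using continuous_map_open_preimage[OF op[OF i]] hol[OF i] loc
      by (auto simp: holomorphic_into_def local_coordinate_def complex_chart_def)
  qed
  moreover have "{s \<in> (\<Union>i\<in>I. D i). g s \<in> U} = (\<Union>i\<in>I. {s \<in> D i. f i s \<in> U})"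
    using eq by auto
  ultimately show "(z \<circ> g) holomorphic_on {s \<in> (\<Union>i\<in>I. D i). g s \<in> U}"
    by simp
qed

section \<open>The identity theorem for maps into the surface\<close>

text \<open>Distinct values at \<open>s\<close> are separated by disjoint open sets, so the maps
  differ nearby. If the values coincide, one chart contains both images of a small disc, and the
  difference of the two coordinate expressions either vanishes identically or has isolated
  zeros.\<close>

lemma holomorphic_into_eq_or_isolated:
  assumes rs: "riemann_surface X \<A>" and "open D"
    and f: "holomorphic_into X \<A> D f" and g: "holomorphic_into X \<A> D g" and s: "s \<in> D"
  shows "(\<forall>\<^sub>F w in nhds s. f w = g w) \<or> (\<forall>\<^sub>F w in at s. f w \<noteq> g w)"
proof -
  have cf: "continuous_map (top_of_set D) X f" and cg: "continuous_map (top_of_set D) X g"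
    using f g by (auto simp: holomorphic_into_def)
  then have top: "f s \<in> topspace X" "g s \<in> topspace X"
    using s by (auto simp: continuous_map_def)
  show ?thesis
  proof (cases "f s = g s")
    case False
    have "Hausdorff_space X"
      using rs by (simp add: riemann_surface_def)
    then obtain V W where VW: "openin X V" "openin X W" "f s \<in> V" "g s \<in> W" "disjnt V W"
      using False top unfolding Hausdorff_space_def by blast
    have "\<forall>\<^sub>F w in nhds s. f w \<noteq> g w"
      using continuous_map_eventually_in[OF \<open>open D\<close> cf VW(1) s VW(3)]
        continuous_map_eventually_in[OF \<open>open D\<close> cg VW(2) s VW(4)]
      by eventually_elim (use VW(5) in \<open>auto simp: disjnt_iff\<close>)
    then show ?thesis
      by (auto simp: eventually_nhds_conv_at)
  next
    case True
    obtain U z where U: "f s \<in> U" "complex_chart X U z" "local_coordinate X \<A> U z"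
      using atlas_coordinate_at[OF rs top(1)] by metis
    have opU: "openin X U"
      using U by (simp add: complex_chart_def)
    have "\<forall>\<^sub>F w in nhds s. (w \<in> D \<and> f w \<in> U) \<and> (w \<in> D \<and> g w \<in> U)"
      using continuous_map_eventually_in[OF \<open>open D\<close> cf opU s] 
        continuous_map_eventually_in[OF \<open>open D\<close> cg opU s] U(1) True
      by (simp add: eventually_conj_iff)
    then obtain r where r: "r > 0" "\<And>w. w \<in> ball s r \<Longrightarrow> w \<in> D \<and> f w \<in> U \<and> g w \<in> U"
      by (auto simp: eventually_nhds_metric dist_commute)
    have "(z \<circ> h) holomorphic_on ball s r"
      if "holomorphic_into X \<A> D h" "\<And>w. w \<in> ball s r \<Longrightarrow> w \<in> D \<and> h w \<in> U" for h
    proof (rule holomorphic_on_subset)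
      show "(z \<circ> h) holomorphic_on {w \<in> D. h w \<in> U}"
        using that(1) U(3) by (simp add: holomorphic_into_def)
    qed (use that(2) in blast)
    then have "(z \<circ> f) holomorphic_on ball s r" "(z \<circ> g) holomorphic_on ball s r"
      using f g r(2) by blast+
    then have h: "(\<lambda>w. z (f w) - z (g w)) holomorphic_on ball s r"
      by (auto simp: o_def intro: holomorphic_on_diff)
    \<comment> \<open>Injectivity of the coordinate turns coincidences of the maps into zeros of a
      scalar holomorphic function.\<close>
    have inj: "f w = g w \<longleftrightarrow> z (f w) - z (g w) = 0" if "w \<in> ball s r" for w
      using r(2)[OF that] complex_chart_inj_on[OF U(2)] by (auto simp: inj_on_eq_iff)
    show ?thesis
    proof (cases "\<forall>w\<in>ball s r. f w = g w")
      case True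
      then show ?thesis
        using eventually_nhds_in_open[of "ball s r" s] r(1) by (auto elim!: eventually_mono)
    next
      case False
      then obtain b where b: "b \<in> ball s r" "z (f b) - z (g b) \<noteq> 0"
        using inj by blast
      obtain e where e: "0 < e" "ball s e \<subseteq> ball s r"
          "\<And>w. w \<in> ball s e - {s} \<Longrightarrow> z (f w) - z (g w) \<noteq> 0"
        using isolated_zeros[OF h open_ball connected_ball, of s b] r(1) \<open>f s = g s\<close> b
        by (metis centre_in_ball right_minus_eq)
      have "\<forall>\<^sub>F w in at s. w \<in> ball s e - {s}"
        using e(1) by (intro eventually_at_in_open) auto
      then have "\<forall>\<^sub>F w in at s. f w \<noteq> g w"
        by eventually_elim (use e(3) in fastforce)
      then show ?thesis ..
    qed
  qed
qed

text \<open>By the local dichotomy, \<open>D\<close> splits into the points near which the maps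
  agree (\<open>A\<close>) and those with a punctured neighbourhood of disagreement
  (\<open>B\<close>). Both parts are open, so connectedness leaves only one; \<open>p\<close>, an
  accumulation point of coincidences, lies in \<open>A\<close>.\<close>

lemma holomorphic_into_identity:
  assumes rs: "riemann_surface X \<A>" and D: "open D" "connected D"
    and f: "holomorphic_into X \<A> D f" and g: "holomorphic_into X \<A> D g"
    and p: "p \<in> D" "\<exists>\<^sub>F w in at p. f w = g w" and s: "s \<in> D"
  shows "f s = g s"
proof -
  define A where "A = {s. \<forall>\<^sub>F w in nhds s. f w = g w}"
  define B where "B = {s. \<forall>\<^sub>F w in at s. f w \<noteq> g w}"
  have disj: "A \<inter> B = {}"
  proof -
    have False if "s \<in> A" "s \<in> B" for s
    proof -
      have "\<forall>\<^sub>F w in at s. f w = g w" "\<forall>\<^sub>F w in at s. f w \<noteq> g w"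
        using that by (auto simp: A_def B_def eventually_nhds_conv_at)
      then have "\<forall>\<^sub>F w in at s. False"
        by eventually_elim simp
      then show False
        by (simp add: trivial_limit_def[symmetric])
    qed
    then show ?thesis
      by blast
  qed
  have cover: "D \<subseteq> A \<union> B"
    using holomorphic_into_eq_or_isolated[OF rs D(1) f g] by (auto simp: A_def B_def)
  have "open A"
    unfolding A_def by (subst open_subopen) (auto simp: eventually_nhds)
  \<comment> \<open>Near a point of \<open>B\<close> the maps differ at every other point; such a
    point is not in \<open>A\<close>, hence is in \<open>B\<close> by the dichotomy.\<close>
  moreover have "open (D \<inter> B)"
  proof (subst open_subopen, intro ballI)
    fix s
    assume s: "s \<in> D \<inter> B"
    then have "\<forall>\<^sub>F w in nhds s. w \<noteq> s \<longrightarrow> f w \<noteq> g w"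
      by (simp add: B_def eventually_at_filter)
    then obtain T where T: "open T" "s \<in> T" "\<And>w. w \<in> T \<Longrightarrow> w \<noteq> s \<Longrightarrow> f w \<noteq> g w"
      by (auto simp: eventually_nhds)
    have "w \<in> B" if "w \<in> T \<inter> D" for w
    proof (cases "w = s")
      case False
      then have "f w \<noteq> g w"
        using T(3) that by auto
      then have "w \<notin> A"
        by (auto simp: A_def dest: eventually_nhds_x_imp_x)
      then show ?thesis
        using cover that by auto
    qed (use s in auto)
    then show "\<exists>T. open T \<and> s \<in> T \<and> T \<subseteq> D \<inter> B"
      using T D(1) s by (intro exI[of _ "T \<inter> D"]) auto
  qed
  moreover have "p \<in> A"
    using p cover by (auto simp: B_def frequently_def)
  ultimately have "D \<inter> (D \<inter> B) = {}"
    using connectedD[OF D(2), of A "D \<inter> B"] disj cover p(1) by blast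
  then have "s \<in> A"
    using cover s by blast
  then show ?thesis
    by (auto simp: A_def dest: eventually_nhds_x_imp_x)
qed

section \<open>Injectivity near an embedded arc\<close>

text \<open>
  A sequence of pairs \<open>p \<noteq> q\<close> with \<open>f p = f q\<close> and \<open>p\<close>
  approaching \<open>I\<close> has no limit pair: off \<open>I\<close> the points \<open>q\<close> stay in a
  compact set, and on \<open>I\<close>, which need not be compact, the embedding hypothesis makes
  them converge to the limit of the \<open>p\<close>. Either way local injectivity is violated.
\<close>

lemma inj_on_near_compact:
  fixes f :: "'b::metric_space \<Rightarrow> 'a" and N :: "nat \<Rightarrow> 'b set"
  assumes haus: "Hausdorff_space X" and cont: "continuous_map (top_of_set S) X f"
    and L: "compact L" "L \<subseteq> S" and I: "I \<subseteq> S" and inj: "inj_on f (L \<union> I)"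
    and loc: "\<And>p. p \<in> I \<Longrightarrow> \<exists>r>0. inj_on f (ball p r)"
    and emb: "\<And>p e. p \<in> I \<Longrightarrow> e > 0 \<Longrightarrow>
      \<exists>V. openin X V \<and> f p \<in> V \<and> (\<forall>q\<in>I. f q \<in> V \<longrightarrow> q \<in> ball p e)"
    and N: "\<And>n. compact (N n)" "\<And>n. N n \<subseteq> S" "decseq N" "(\<Inter>n. N n) \<subseteq> I"
  shows "\<exists>n. inj_on f (L \<union> N n \<union> I)"
proof (rule ccontr)
  assume contr: "\<not> ?thesis"
  have "\<forall>n. \<exists>p q. p \<in> N n \<and> q \<in> L \<union> N n \<union> I \<and> p \<noteq> q \<and> f p = f q"
  proof (intro allI)
    fix n
    have "\<not> inj_on f (L \<union> N n \<union> I)"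
      using contr by blast
    then obtain x y where xy: "x \<in> L \<union> N n \<union> I" "y \<in> L \<union> N n \<union> I" "x \<noteq> y" "f x = f y"
      unfolding inj_on_def by blast
    \<comment> \<open>Injectivity on \<open>L \<union> I\<close> excludes pairs that avoid
      \<open>N n\<close>; the member in \<open>N n\<close> is named \<open>p\<close>.\<close>
    then have "x \<in> N n \<or> y \<in> N n"
      using inj unfolding inj_on_def by blast
    then show "\<exists>p q. p \<in> N n \<and> q \<in> L \<union> N n \<union> I \<and> p \<noteq> q \<and> f p = f q"
      using xy by metis
  qed
  then obtain p q where p: "\<And>n. p n \<in> N n" and q: "\<And>n. q n \<in> L \<union> N n \<union> I"
    and pq: "\<And>n. p n \<noteq> q n" "\<And>n. f (p n) = f (q n)"
    by metis
  have Nmono: "N n \<subseteq> N m" if "m \<le> n" for m n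
    using N(3) that by (simp add: decseq_def)
  have lim_mem: "l \<in> C" 
    if "closed C" "y \<longlonglongrightarrow> l" "\<forall>\<^sub>F n in sequentially. y n \<in> C" for C :: "'b set" and y l
    using Lim_in_closed_set[OF that(1,3) _ that(2)] by simp
  have "\<forall>n. p n \<in> N 0"
    using p Nmono by blast
  then obtain l s where s: "strict_mono s" and pl: "(p \<circ> s) \<longlonglongrightarrow> l"
    using N(1)[of 0] unfolding compact_def by meson
  have s_ge: "n \<le> s n" for n
    using s by (rule seq_suble)
  \<comment> \<open>The sets are nested and closed, so the limit of the subsequence lies in all of
    them and hence in \<open>I\<close>.\<close>
  have "l \<in> N m" for m
  proof (rule lim_mem[OF compact_imp_closed[OF N(1)] pl])
    show "\<forall>\<^sub>F n in sequentially. (p \<circ> s) n \<in> N m"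
      using eventually_ge_at_top[of m]
    proof eventually_elim
      case (elim n)
      then show ?case
        using p Nmono[of m "s n"] s_ge[of n] by force
    qed
  qed
  then have l: "l \<in> I"
    using N(4) by auto
  have lim: "limitin X (f \<circ> y) (f c) sequentially"
    if "y \<longlonglongrightarrow> c" "\<forall>n. y n \<in> S" "c \<in> S" for y c
    using that by (intro continuous_map_limit[OF cont]) (auto simp: limitin_subtopology)
  have pS: "\<forall>n. p n \<in> S"
    using p N(2) by blast
  have fpl: "limitin X (f \<circ> (p \<circ> s)) (f l) sequentially"
    using lim[OF pl] pS l I by auto
  obtain r where r: "r > 0" "inj_on f (ball l r)"
    using loc[OF l] by blast
  have far: "\<not> (p n \<in> ball l r \<and> q n \<in> ball l r)" for n
    using inj_onD[OF r(2) pq(2)[of n]] pq(1)[of n] by blast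
  have p_near: "\<forall>\<^sub>F n in sequentially. p (s n) \<in> ball l r"
    using topological_tendstoD[OF pl, of "ball l r"] r(1) by simp
  show False
  proof (cases "\<exists>\<^sub>F n in sequentially. q (s n) \<in> I")
    case True
    obtain V where V: "openin X V" "f l \<in> V" "\<And>q. q \<in> I \<Longrightarrow> f q \<in> V \<Longrightarrow> q \<in> ball l r"
      using emb[OF l r(1)] by blast
    have "\<forall>\<^sub>F n in sequentially. f (p (s n)) \<in> V"
      using fpl V by (auto simp: limitin_def)
    with p_near have "\<forall>\<^sub>F n in sequentially. q (s n) \<notin> I"
    proof eventually_elim
      case (elim n)
      then show ?case
        using V(3)[of "q (s n)"] far[of "s n"] pq(2)[of "s n"] by auto
    qed
    with True show False
      by (simp add: frequently_def)
  next
    case False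
    then have "\<forall>\<^sub>F n in sequentially. q (s n) \<notin> I"
      by (simp add: frequently_def)
    then obtain k where k: "\<And>n. k \<le> n \<Longrightarrow> q (s n) \<notin> I"
      by (auto simp: eventually_sequentially)
    \<comment> \<open>Dropping the first \<open>k\<close> terms puts every remaining
      \<open>q\<close> into the compact set \<open>L \<union> N 0\<close>, where a further
      subsequence converges.\<close>
    define s' where "s' = (\<lambda>n. s (n + k))"
    have s': "strict_mono s'"
      using s by (simp add: s'_def strict_mono_def)
    have qs': "q (s' n) \<in> L \<union> N (s' n)" for n
      using k[of "n + k"] q[of "s' n"] by (auto simp: s'_def)
    then have "\<forall>n. (q \<circ> s') n \<in> L \<union> N 0"
      using Nmono[of 0] by fastforce
    moreover have "compact (L \<union> N 0)"
      using L N(1) by (intro compact_Un) auto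
    ultimately obtain c u where u: "strict_mono u" and qc: "((q \<circ> s') \<circ> u) \<longlonglongrightarrow> c"
      unfolding compact_def by meson
    have u_ge: "m \<le> s' (u n)" if "m \<le> n" for m n
      using seq_suble[OF s', of "u n"] seq_suble[OF u, of n] that by linarith
    have "c \<in> L \<union> N m" for m
    proof (rule lim_mem[OF _ qc])
      show "closed (L \<union> N m)"
        using L N(1) by (auto intro: compact_imp_closed)
      show "\<forall>\<^sub>F n in sequentially. ((q \<circ> s') \<circ> u) n \<in> L \<union> N m"
        using eventually_ge_at_top[of m]
      proof eventually_elim
        case (elim n)
        then show ?case
          using qs'[of "u n"] Nmono[OF u_ge[OF elim]] by auto
      qed
    qed
    then have c: "c \<in> L \<union> I"
      using N(4) by blast
    have ev: "strict_mono (\<lambda>n. u n + k)"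
      using u by (simp add: strict_mono_def)
    have "(p \<circ> s \<circ> (\<lambda>n. u n + k)) \<longlonglongrightarrow> l"
      by (rule LIMSEQ_subseq_LIMSEQ[OF pl ev])
    then have pl': "(p \<circ> s' \<circ> u) \<longlonglongrightarrow> l"
      by (simp add: s'_def o_def)
    have "limitin X (f \<circ> (p \<circ> s' \<circ> u)) (f l) sequentially"
      using lim[OF pl'] pS l I by auto
    moreover have "limitin X (f \<circ> (q \<circ> s' \<circ> u)) (f c) sequentially"
      using lim[OF qc] q c L(2) I N(2) by (metis (no_types, lifting) Un_iff comp_apply subsetD)
    moreover have "f \<circ> (p \<circ> s' \<circ> u) = f \<circ> (q \<circ> s' \<circ> u)"
      using pq(2) by (simp add: fun_eq_iff)
    \<comment> \<open>The image sequences are equal and limits in a Hausdorff space are unique.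
      Injectivity on \<open>L \<union> I\<close> then gives \<open>c = l\<close>, and both members
      of a pair end up in the ball on which \<open>f\<close> is injective.\<close>
    ultimately have "f l = f c"
      using limitin_Hausdorff_unique[OF _ _ _ haus] by (metis sequentially_bot)
    then have "c = l"
      using inj c l by (auto simp: inj_on_def)
    then have "\<forall>\<^sub>F n in sequentially. (q \<circ> s' \<circ> u) n \<in> ball l r"
      using topological_tendstoD[OF qc, of "ball l r"] r(1) by simp
    moreover have "\<forall>\<^sub>F n in sequentially. (p \<circ> s' \<circ> u) n \<in> ball l r"
      using topological_tendstoD[OF pl', of "ball l r"] r(1) by simp
    ultimately have "\<forall>\<^sub>F n in sequentially. False"
      by eventually_elim (use far in auto)
    then show False
      by simp
  qed
qed

section \<open>Exhausting the interval by compact segments\<close>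

text \<open>The open interval is exhausted by compact segments. At each stage
  \<open>inj_on_near_compact\<close> allows a sufficiently thin closed rectangle about the next
  segment to be added to the compact set already built; the interiors of these sets make up
  \<open>\<Omega>\<close>.\<close>

lemma inj_on_neighbourhood_of_interval:
  fixes f :: "complex \<Rightarrow> 'a"
  defines "I \<equiv> of_real ` unit_interval"
  assumes haus: "Hausdorff_space X" and S: "open S" and cont: "continuous_map (top_of_set S) X f"
    and I: "I \<subseteq> S" and inj: "inj_on f I"
    and loc: "\<And>p. p \<in> I \<Longrightarrow> \<exists>r>0. inj_on f (ball p r)"
    and emb: "\<And>p e. p \<in> I \<Longrightarrow> e > 0 \<Longrightarrow>
      \<exists>V. openin X V \<and> f p \<in> V \<and> (\<forall>q\<in>I. f q \<in> V \<longrightarrow> q \<in> ball p e)"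
  obtains \<Omega> where "open \<Omega>" "I \<subseteq> \<Omega>" "\<Omega> \<subseteq> S" "inj_on f \<Omega>"
proof -
  \<comment> \<open>The segments \<open>{a n..b n}\<close> lie inside the open unit interval,
    increase, and exhaust it. The first one is the single point \<open>1/2\<close>, as
    \<open>a 0 = b 0\<close>.\<close>
  define a b :: "nat \<Rightarrow> real" where "a n = 1 / (real n + 2)" and "b n = 1 - a n" for n
  have step: "\<exists>L'. (compact L' \<and> L' \<subseteq> S \<and> inj_on f (L' \<union> I)) \<and>
      (L \<subseteq> L' \<and> of_real ` {a n<..<b n} \<subseteq> interior L')"
    if L: "compact L \<and> L \<subseteq> S \<and> inj_on f (L \<union> I)" for L n
  proof -
    have real_mem: "of_real x \<in> I" if "x \<in> {a n..b n}" for x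
    proof -
      have "0 < a n"
        by (simp add: a_def)
      then show ?thesis
        using that by (auto simp: I_def unit_interval_def b_def)
    qed
    have "compact (of_real ` {a n..b n} :: complex set)"
      by (intro compact_continuous_image continuous_intros) auto
    moreover have "of_real ` {a n..b n} \<subseteq> S"
      using real_mem I by auto
    ultimately obtain e where e: "e > 0" "(\<Union>x\<in>of_real ` {a n..b n}. ball x e) \<subseteq> S"
      using compact_subset_open_imp_ball_epsilon_subset[OF _ S] by metis
    \<comment> \<open>The half-heights decrease to 0, so the rectangles shrink to the segment; the
      summand 2 keeps them strictly below \<open>e\<close>, so that every rectangle lies in
      \<open>S\<close>.\<close>
    define h where "h k = e / (real k + 2)" for k
    define N where "N k = cbox (Complex (a n) (- h k)) (Complex (b n) (h k))" for k
    have N_iff: "w \<in> N k \<longleftrightarrow> a n \<le> Re w \<and> Re w \<le> b n \<and> \<bar>Im w\<bar> \<le> h k" for w k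
      by (auto simp: N_def in_cbox_complex_iff)
    have h: "0 < h k" "h k < e" for k
      using e(1) by (auto simp: h_def field_simps add_pos_nonneg)
    have NS: "N k \<subseteq> S" for k
    proof
      fix w
      assume w: "w \<in> N k"
      have "dist (of_real (Re w)) w = \<bar>Im w\<bar>"
        by (simp add: dist_norm cmod_def)
      then have "w \<in> ball (of_real (Re w)) e"
        using w h(2)[of k] by (simp add: N_iff)
      moreover have "Re w \<in> {a n..b n}"
        using w by (simp add: N_iff)
      ultimately show "w \<in> S"
        using e(2) by blast
    qed
    have "\<exists>k. inj_on f (L \<union> N k \<union> I)"
    proof (rule inj_on_near_compact[OF haus cont _ _ I _ loc emb])
      have "h k \<le> h m" if "m \<le> k" for m k
        using that e(1) by (auto simp: h_def intro: divide_left_mono)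
      then show "decseq N"
        by (force simp: decseq_def N_iff)
      show "(\<Inter>k. N k) \<subseteq> I"
      proof
        fix w
        assume w: "w \<in> (\<Inter>k. N k)"
        have "h \<longlonglongrightarrow> 0"
          unfolding h_def by real_asymp
        moreover have "\<bar>Im w\<bar> \<le> h k" for k
          using w by (auto simp: N_iff)
        ultimately have "\<bar>Im w\<bar> \<le> 0"
          by (intro LIMSEQ_le_const) auto
        then have "w = of_real (Re w)"
          by (simp add: complex_eq_iff)
        moreover have "Re w \<in> {a n..b n}"
          using w by (auto simp: N_iff)
        ultimately show "w \<in> I"
          using real_mem by metis
      qed
    qed (use L NS in \<open>auto simp: N_def\<close>)
    then obtain k where k: "inj_on f (L \<union> N k \<union> I)" ..
    \<comment> \<open>The endpoints of the segment lie on the boundary of the rectangle, so only the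
      open segment is interior.\<close>
    have "of_real ` {a n<..<b n} \<subseteq> box (Complex (a n) (- h k)) (Complex (b n) (h k))"
      using h(1)[of k] by (auto simp: in_box_complex_iff)
    also have "\<dots> \<subseteq> interior (L \<union> N k)"
      by (intro interior_maximal) (auto simp: N_def box_subset_cbox[THEN subsetD])
    finally show ?thesis
      using L k NS by (intro exI[of _ "L \<union> N k"]) (auto simp: N_def)
  qed
  \<comment> \<open>Keeping \<open>I\<close> in the set of injectivity lets the compact sets grow one by one,
    and injectivity passes to their increasing union.\<close>
  obtain L where L: "\<And>n. compact (L n) \<and> L n \<subseteq> S \<and> inj_on f (L n \<union> I)"
      "\<And>n. L n \<subseteq> L (Suc n) \<and> of_real ` {a n<..<b n} \<subseteq> interior (L (Suc n))"
    using dependent_nat_choice[of "\<lambda>_ L. compact L \<and> L \<subseteq> S \<and> inj_on f (L \<union> I)"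
        "\<lambda>n L L'. L \<subseteq> L' \<and> of_real ` {a n<..<b n} \<subseteq> interior L'"] step inj
    by (metis compact_empty empty_subsetI sup_bot_left)
  have mono: "L m \<subseteq> L n" if "m \<le> n" for m n
    using lift_Suc_mono_le[of L] L(2) that by blast
  show thesis
  proof (rule that[of "\<Union>n. interior (L n)"])
    show "I \<subseteq> (\<Union>n. interior (L n))"
    proof
      fix w
      assume "w \<in> I"
      then obtain x where x: "0 < x" "x < 1" "w = of_real x"
        by (auto simp: I_def unit_interval_def)
      have "a \<longlonglongrightarrow> 0"
        unfolding a_def by real_asymp
      then have "\<forall>\<^sub>F n in sequentially. a n < min x (1 - x)"
        using x by (intro order_tendstoD) auto
      then obtain n where "a n < min x (1 - x)"
        by (auto simp: eventually_sequentially)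
      then have "x \<in> {a n<..<b n}"
        by (auto simp: b_def)
      then show "w \<in> (\<Union>n. interior (L n))"
        using L(2)[of n] x(3) by blast
    qed
    show "(\<Union>n. interior (L n)) \<subseteq> S"
      using L(1) interior_subset by blast
    show "inj_on f (\<Union>n. interior (L n))"
    proof (rule inj_onI)
      fix v w
      assume "v \<in> (\<Union>n. interior (L n))" "w \<in> (\<Union>n. interior (L n))" and eq: "f v = f w"
      then obtain m n where "v \<in> L m" "w \<in> L n"
        using interior_subset by blast
      then have "v \<in> L (max m n)" "w \<in> L (max m n)"
        using mono[of m "max m n"] mono[of n "max m n"] by auto
      then show "v = w"
        using L(1)[of "max m n"] eq by (auto simp: inj_on_def)
    qed
  qed auto
qed

section \<open>Analytic and conformal parametrizations\<close>

text \<open>The power series of \<open>z \<circ> \<phi>\<close> is evaluated at complex arguments,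
  giving \<open>F\<close>. Its derivative at \<open>t\<close> is that of
  \<open>z \<circ> \<phi>\<close>, hence nonzero, so \<open>F\<close> is injective near
  \<open>t\<close>; the inverse chart carries it back to the surface. Keeping the real points of the
  disc inside the unit interval prepares the comparison of different discs.\<close>

lemma local_conformal_extension:
  assumes rs: "riemann_surface X \<A>" and top: "\<phi> t \<in> topspace X"
    and an: "analytic_param X \<A> \<phi>" and nv: "nonvanishing_derivative X \<A> \<phi>"
    and t: "t \<in> unit_interval"
  obtains r \<Psi> where "r > 0" "holomorphic_into X \<A> (ball (of_real t) r) \<Psi>"
    "inj_on \<Psi> (ball (of_real t) r)"
    "\<And>x. of_real x \<in> ball (of_real t :: complex) r \<Longrightarrow> x \<in> unit_interval \<and> \<Psi> (of_real x) = \<phi> x"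
proof -
  obtain U z where U: "(U, z) \<in> \<A>" "\<phi> t \<in> U" "complex_chart X U z" "local_coordinate X \<A> U z"
    using atlas_coordinate_at[OF rs top] by metis
  obtain c :: "nat \<Rightarrow> complex" where
    "\<forall>\<^sub>F x in nhds t. \<phi> x \<in> U \<and> (\<lambda>j. c j * of_real (x - t) ^ j) sums (z \<circ> \<phi>) x"
    using an t U unfolding analytic_param_def by blast
  then obtain d where d: "d > 0" "\<And>x. dist x t < d \<Longrightarrow>
      \<phi> x \<in> U \<and> (\<lambda>j. c j * of_real (x - t) ^ j) sums z (\<phi> x)"
    by (auto simp: eventually_nhds_metric)
  define F where "F w = (\<Sum>j. c j * (w - of_real t) ^ j)" for w
  let ?B = "ball (of_real t :: complex) (d / 2)"
  \<comment> \<open>Convergence at the single real point \<open>t + d / 2\<close>, which is within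
    \<open>d\<close> of \<open>t\<close>, forces convergence on the whole complex disc of radius
    \<open>d / 2\<close>.\<close>
  have "summable (\<lambda>j. c j * of_real (d / 2) ^ j)"
  proof -
    have "dist (t + d / 2) t < d"
      using d(1) by (simp add: dist_real_def)
    then have "(\<lambda>j. c j * of_real (t + d / 2 - t) ^ j) sums z (\<phi> (t + d / 2))"
      using d(2) by blast
    moreover have "t + d / 2 - t = d / 2"
      by simp
    ultimately show ?thesis
      by (simp only: sums_summable)
  qed
  then have F_sums: "(\<lambda>j. c j * (w - of_real t) ^ j) sums F w" if "w \<in> ?B" for w
  proof -
    have "norm (w - of_real t) < norm (of_real (d / 2) :: complex)"
      using that d(1) by (simp add: dist_norm norm_minus_commute del: of_real_divide)
    then show ?thesis
      unfolding F_def by (intro summable_sums powser_inside[OF \<open>summable _\<close>])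
  qed
  have F_hol: "F holomorphic_on ?B"
    using F_sums by (rule power_series_holomorphic)
  have F_real: "F (of_real x) = z (\<phi> x)" if "dist x t < d / 2" for x
  proof -
    have "of_real x \<in> ?B"
      using that by (simp add: dist_commute)
    then have "(\<lambda>j. c j * of_real (x - t) ^ j) sums F (of_real x)"
      using F_sums[of "of_real x"] by simp
    moreover have "(\<lambda>j. c j * of_real (x - t) ^ j) sums z (\<phi> x)"
      using d that by auto
    ultimately show ?thesis
      by (rule sums_unique2)
  qed
  obtain D where D: "((z \<circ> \<phi>) has_vector_derivative D) (at t)" "D \<noteq> 0"
    using nv t U unfolding nonvanishing_derivative_def by blast
  \<comment> \<open>Along the real axis the complex derivative of \<open>F\<close> becomes the
    vector derivative of \<open>z \<circ> \<phi>\<close>; uniqueness identifies it with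
    \<open>D\<close>.\<close>
  have "(F has_field_derivative deriv F (of_real t)) (at (of_real t))"
    using F_hol d(1) by (intro holomorphic_derivI[of F ?B]) auto
  then have "((\<lambda>x. F (of_real x)) has_vector_derivative deriv F (of_real t)) (at t)"
    by (rule has_vector_derivative_real_field)
  then have "((z \<circ> \<phi>) has_vector_derivative deriv F (of_real t)) (at t)"
    by (rule has_vector_derivative_transform_within_open[of _ _ _ "ball t (d / 2)"])
      (use d(1) F_real in \<open>auto simp: dist_commute\<close>)
  then have "deriv F (of_real t) \<noteq> 0"
    using D vector_derivative_unique_at by blast
  then obtain \<rho> where \<rho>: "\<rho> > 0" "inj_on F (ball (of_real t) \<rho>)"
    using has_complex_derivative_locally_injective[OF F_hol] d(1)
    by (metis centre_in_ball half_gt_zero open_ball)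
  have "open (z ` U)"
    using U by (simp add: complex_chart_def)
  then have "open (?B \<inter> F -` (z ` U))"
    using F_hol by (intro continuous_open_preimage holomorphic_on_imp_continuous_on) auto
  moreover have "of_real t \<in> ?B \<inter> F -` (z ` U)"
    using d(1) F_real[of t] U(2) by simp
  ultimately obtain \<sigma> where \<sigma>: "\<sigma> > 0" "ball (of_real t) \<sigma> \<subseteq> ?B \<inter> F -` (z ` U)"
    by (meson open_contains_ball)
  \<comment> \<open>\<open>\<rho>\<close> secures injectivity of \<open>F\<close>,
    \<open>\<sigma>\<close> keeps its values in the chart, \<open>t\<close> and \<open>1 - t\<close>
    keep real points in the unit interval, and \<open>d / 2\<close> is the radius on which
    \<open>F\<close> agrees with \<open>z \<circ> \<phi>\<close>.\<close>
  define r where "r = min \<rho> (min \<sigma> (min t (min (1 - t) (d / 2))))"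
  have r: "r > 0" "r \<le> \<rho>" "r \<le> \<sigma>" "r \<le> t" "r \<le> 1 - t" "r \<le> d / 2"
    using \<rho>(1) \<sigma>(1) t d(1) by (auto simp: r_def unit_interval_def min_def)
  have sub: "ball (of_real t) r \<subseteq> ball (of_real t :: complex) \<rho>"
    "ball (of_real t) r \<subseteq> ball (of_real t :: complex) \<sigma>"
    using r by auto
  show thesis
  proof (rule that[of r "inv_into U z \<circ> F"])
    have FzU: "F ` ball (of_real t) r \<subseteq> z ` U"
      using sub(2) \<sigma>(2) by auto
    show "holomorphic_into X \<A> (ball (of_real t) r) (inv_into U z \<circ> F)"
    proof (rule holomorphic_into_inverse_chart[OF U(1,3) _ FzU])
      show "F holomorphic_on ball (of_real t) r"
        using F_hol by (rule holomorphic_on_subset) (use sub(2) \<sigma>(2) in auto)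
    qed
    show "inj_on (inv_into U z \<circ> F) (ball (of_real t) r)"
      by (intro comp_inj_on inj_on_subset[OF \<rho>(2) sub(1)] inj_on_inv_into FzU)
    fix x
    assume "of_real x \<in> ball (of_real t :: complex) r"
    then have x: "dist x t < r"
      by (simp add: dist_commute)
    then have "F (of_real x) = z (\<phi> x)" "\<phi> x \<in> U"
      using F_real[of x] d(2)[of x] r d(1) by auto
    moreover have "x \<in> unit_interval"
      using x r by (auto simp: unit_interval_def dist_real_def)
    ultimately show "x \<in> unit_interval \<and> (inv_into U z \<circ> F) (of_real x) = \<phi> x"
      using complex_chart_inj_on[OF U(3)] by simp
  qed (use r in simp)
qed

text \<open>Approaching \<open>of_real x\<close> along the real axis meets \<open>P\<close> at
  points arbitrarily close to it and different from it. This supplies the accumulation point of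
  coincidences for the identity theorem.\<close>

lemma frequently_at_of_real:
  fixes x :: real and S :: "complex set" and P :: "complex \<Rightarrow> bool"
  assumes "open S" "of_real x \<in> S"
    and "\<And>y. of_real y \<in> S \<Longrightarrow> P (of_real y)"
  shows "\<exists>\<^sub>F w in at (of_real x). P w"
proof -
  have "((\<lambda>y. complex_of_real y) \<longlongrightarrow> of_real x) (at x)"
    by (intro tendsto_intros)
  then have lim: "filterlim complex_of_real (at (of_real x)) (at x)"
    by (auto simp: filterlim_at eventually_at_filter)
  have "\<not> (\<forall>\<^sub>F w in at (of_real x). \<not> P w)"
  proof
    assume "\<forall>\<^sub>F w in at (of_real x). \<not> P w"
    moreover have "\<forall>\<^sub>F w in at (of_real x). w \<in> S"
      using assms(1,2) by (intro eventually_at_in_open') auto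
    ultimately have "\<forall>\<^sub>F w in at (of_real x). w \<in> S \<and> \<not> P w"
      by eventually_elim simp
    then have "\<forall>\<^sub>F y in at x. of_real y \<in> S \<and> \<not> P (of_real y)"
      using lim by (auto simp: filterlim_iff)
    then have "\<forall>\<^sub>F y in at x. False"
      by eventually_elim (use assms(3) in auto)
    then show False
      by (simp add: trivial_limit_def[symmetric])
  qed
  then show ?thesis
    by (simp add: frequently_def)
qed

section \<open>Arcs as embedded intervals\<close>

lemma arc_parametrization_facts:
  assumes "arc_parametrization X J \<phi>" "J \<subseteq> topspace X"
  shows "\<phi> ` unit_interval = J" "inj_on \<phi> unit_interval"
  using assms homeomorphic_imp_surjective_map[of "top_of_set unit_interval" "subtopology X J" \<phi>]
    homeomorphic_imp_injective_map[of "top_of_set unit_interval" "subtopology X J" \<phi>]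
  by (auto simp: arc_parametrization_def)

text \<open>Continuity of the inverse of \<open>\<phi>\<close>, phrased with open sets of
  \<open>X\<close>: \<open>\<phi>\<close> is open onto \<open>J\<close>, so the image of a short
  interval is the trace on \<open>J\<close> of an open set \<open>V\<close>.\<close>

lemma arc_parametrization_embedding:
  assumes \<phi>: "arc_parametrization X J \<phi>" "J \<subseteq> topspace X" and t: "t \<in> unit_interval"
    and "e > 0"
  obtains V where "openin X V" "\<phi> t \<in> V" "\<And>x. x \<in> unit_interval \<Longrightarrow> \<phi> x \<in> V \<Longrightarrow> x \<in> ball t e"
proof -
  have "open_map (top_of_set unit_interval) (subtopology X J) \<phi>"
    using \<phi> by (simp add: arc_parametrization_def homeomorphic_imp_open_map)
  moreover have "openin (top_of_set unit_interval) (unit_interval \<inter> ball t e)"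
    by (simp add: openin_open_Int)
  ultimately have "openin (subtopology X J) (\<phi> ` (unit_interval \<inter> ball t e))"
    by (simp add: open_map_def)
  then obtain V where V: "openin X V" "\<phi> ` (unit_interval \<inter> ball t e) = V \<inter> J"
    by (auto simp: openin_subtopology)
  show thesis
  proof (rule that[OF V(1)])
    show "\<phi> t \<in> V"
      using V(2) t \<open>e > 0\<close> by force
    fix x
    assume x: "x \<in> unit_interval" "\<phi> x \<in> V"
    then have "\<phi> x \<in> V \<inter> J"
      using arc_parametrization_facts[OF \<phi>] by auto
    then have "\<phi> x \<in> \<phi> ` (unit_interval \<inter> ball t e)"
      using V(2) by simp
    then show "x \<in> ball t e"
      using arc_parametrization_facts(2)[OF \<phi>] x by (auto simp: inj_on_def)
  qed
qed

text \<open>Discs centred on the real axis have convex intersections, and an intersection contains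
  the real part of each of its points. On its real points both local extensions equal
  \<open>\<phi>\<close>, so the identity theorem makes them agree and they can be glued.\<close>

lemma holomorphic_extension_of_analytic_arc:
  assumes rs: "riemann_surface X \<A>" and \<phi>: "arc_parametrization X J \<phi>" "J \<subseteq> topspace X"
    and an: "analytic_param X \<A> \<phi>" and nv: "nonvanishing_derivative X \<A> \<phi>"
  obtains S \<Phi> where "open S" "of_real ` unit_interval \<subseteq> S" "holomorphic_into X \<A> S \<Phi>"
    "\<And>t. t \<in> unit_interval \<Longrightarrow> \<Phi> (of_real t) = \<phi> t"
    "\<And>t. t \<in> unit_interval \<Longrightarrow> \<exists>r>0. inj_on \<Phi> (ball (of_real t) r)"
proof -
  have "\<forall>t\<in>unit_interval. \<exists>r \<Psi>. r > 0 \<and> holomorphic_into X \<A> (ball (of_real t) r) \<Psi> \<and>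
    inj_on \<Psi> (ball (of_real t) r) \<and>
    (\<forall>x. of_real x \<in> ball (of_real t :: complex) r \<longrightarrow> x \<in> unit_interval \<and> \<Psi> (of_real x) = \<phi> x)"
  proof
    fix t
    assume t: "t \<in> unit_interval"
    then have "\<phi> t \<in> topspace X"
      using arc_parametrization_facts(1)[OF \<phi>] \<phi>(2) by auto
    from local_conformal_extension[OF rs this an nv t] show "\<exists>r \<Psi>. r > 0 \<and>
      holomorphic_into X \<A> (ball (of_real t) r) \<Psi> \<and> inj_on \<Psi> (ball (of_real t) r) \<and>
      (\<forall>x. of_real x \<in> ball (of_real t :: complex) r \<longrightarrow> x \<in> unit_interval \<and> \<Psi> (of_real x) = \<phi> x)"
      by metis
  qed
  then obtain r \<Psi> where r: "\<And>t. t \<in> unit_interval \<Longrightarrow> r t > 0"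
    and hol: "\<And>t. t \<in> unit_interval \<Longrightarrow> holomorphic_into X \<A> (ball (of_real t) (r t)) (\<Psi> t)"
    and inj: "\<And>t. t \<in> unit_interval \<Longrightarrow> inj_on (\<Psi> t) (ball (of_real t) (r t))"
    and ext: "\<And>t x. t \<in> unit_interval \<Longrightarrow> of_real x \<in> ball (of_real t :: complex) (r t) \<Longrightarrow>
      x \<in> unit_interval \<and> \<Psi> t (of_real x) = \<phi> x"
    by metis
  define D where "D t = ball (complex_of_real t) (r t)" for t
  have agree: "\<Psi> t s = \<Psi> u s"
    if tu: "t \<in> unit_interval" "u \<in> unit_interval" and s: "s \<in> D t" "s \<in> D u" for t u s
  proof -
    \<comment> \<open>Projecting to the real axis does not increase the distance to a real
      centre.\<close>
    have Re_mem: "of_real (Re s) \<in> D v" if "s \<in> D v" for v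
      using that abs_Re_le_cmod[of "of_real v - s"]
      by (auto simp: D_def dist_norm simp flip: of_real_diff)
    show ?thesis
    proof (rule holomorphic_into_identity[OF rs, where D = "D t \<inter> D u" and p = "of_real (Re s)"])
      show "connected (D t \<inter> D u)"
        by (intro convex_connected convex_Int) (auto simp: D_def)
      show "holomorphic_into X \<A> (D t \<inter> D u) (\<Psi> t)"
        by (rule holomorphic_into_subset[OF hol[OF tu(1)]]) (auto simp: D_def)
      show "holomorphic_into X \<A> (D t \<inter> D u) (\<Psi> u)"
        by (rule holomorphic_into_subset[OF hol[OF tu(2)]]) (auto simp: D_def)
      show "\<exists>\<^sub>F w in at (of_real (Re s)). \<Psi> t w = \<Psi> u w"
      proof (rule frequently_at_of_real[of "D t \<inter> D u"])
        fix y
        assume "of_real y \<in> D t \<inter> D u"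
        then show "\<Psi> t (of_real y) = \<Psi> u (of_real y)"
          using ext[OF tu(1), of y] ext[OF tu(2), of y] by (simp add: D_def)
      qed (use Re_mem s in \<open>auto simp: D_def\<close>)
    qed (use Re_mem s in \<open>auto simp: D_def\<close>)
  qed
  \<comment> \<open>Any disc containing \<open>s\<close> may be chosen, since \<open>agree\<close>
    makes the value independent of the choice.\<close>
  define \<Phi> where "\<Phi> s = \<Psi> (SOME t. t \<in> unit_interval \<and> s \<in> D t) s" for s
  have \<Phi>: "\<Phi> s = \<Psi> t s" if "t \<in> unit_interval" "s \<in> D t" for s t
  proof -
    have "(SOME u. u \<in> unit_interval \<and> s \<in> D u) \<in> unit_interval \<and>
        s \<in> D (SOME u. u \<in> unit_interval \<and> s \<in> D u)"
      by (rule someI[of _ t]) (use that in blast)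
    then show ?thesis
      using agree that unfolding \<Phi>_def by blast
  qed
  have centre: "of_real t \<in> D t" if "t \<in> unit_interval" for t
    using r[OF that] by (simp add: D_def)
  show thesis
  proof (rule that[of "\<Union>t\<in>unit_interval. D t" \<Phi>])
    show "holomorphic_into X \<A> (\<Union>t\<in>unit_interval. D t) \<Phi>"
      by (rule holomorphic_into_glue[where f = \<Psi>]) (use \<Phi> hol in \<open>auto simp: D_def\<close>)
    fix t
    assume t: "t \<in> unit_interval"
    show "\<Phi> (of_real t) = \<phi> t"
      using \<Phi>[OF t centre[OF t]] ext[OF t, of t] centre[OF t] by (simp add: D_def)
    have "inj_on \<Phi> (D t)"
      using inj[OF t] \<Phi>[OF t] unfolding inj_on_def by (simp add: D_def)
    then show "\<exists>r>0. inj_on \<Phi> (ball (of_real t) r)"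
      using r[OF t] by (auto simp: D_def)
  qed (use centre in \<open>auto simp: D_def\<close>)
qed

lemma regular_analytic_imp_conformal:
  assumes rs: "riemann_surface X \<A>" and "regular_analytic_open_arc X \<A> J"
  shows "conformal_open_arc X \<A> J"
proof -
  obtain \<phi> where J: "open_arc X J" and \<phi>: "arc_parametrization X J \<phi>"
    and an: "analytic_param X \<A> \<phi>" and nv: "nonvanishing_derivative X \<A> \<phi>"
    using assms(2) by (auto simp: regular_analytic_open_arc_def)
  have JX: "J \<subseteq> topspace X"
    using J by (simp add: open_arc_def)
  obtain S \<Phi> where S: "open S" "of_real ` unit_interval \<subseteq> S" "holomorphic_into X \<A> S \<Phi>"
    and ext: "\<And>t. t \<in> unit_interval \<Longrightarrow> \<Phi> (of_real t) = \<phi> t"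
    and loc: "\<And>t. t \<in> unit_interval \<Longrightarrow> \<exists>r>0. inj_on \<Phi> (ball (of_real t) r)"
    using holomorphic_extension_of_analytic_arc[OF rs \<phi> JX an nv] by metis
  obtain \<Omega> where \<Omega>: "open \<Omega>" "of_real ` unit_interval \<subseteq> \<Omega>" "\<Omega> \<subseteq> S" "inj_on \<Phi> \<Omega>"
  \<comment> \<open>The embedding property of the arc, transferred from \<open>\<phi>\<close> to
    \<open>\<Phi>\<close>, is what turns local injectivity into injectivity on a
    neighbourhood.\<close>
  proof (rule inj_on_neighbourhood_of_interval[OF _ S(1) _ S(2)])
    show "Hausdorff_space X"
      using rs by (simp add: riemann_surface_def)
    show "continuous_map (top_of_set S) X \<Phi>"
      using S(3) by (simp add: holomorphic_into_def)
    show "inj_on \<Phi> (of_real ` unit_interval)"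
      using arc_parametrization_facts(2)[OF \<phi> JX] ext by (auto simp: inj_on_def)
    show "\<exists>V. openin X V \<and> \<Phi> p \<in> V \<and> (\<forall>q\<in>of_real ` unit_interval. \<Phi> q \<in> V \<longrightarrow> q \<in> ball p e)"
      if p: "p \<in> of_real ` unit_interval" and e: "e > 0" for p e
    proof -
      obtain t where t: "t \<in> unit_interval" "p = of_real t"
        using p by blast
      obtain V where "openin X V" "\<phi> t \<in> V" "\<And>x. x \<in> unit_interval \<Longrightarrow> \<phi> x \<in> V \<Longrightarrow> x \<in> ball t e"
        using arc_parametrization_embedding[OF \<phi> JX t(1) e] by metis
      then show ?thesis
        using t ext by (intro exI[of _ V]) auto
    qed
  qed (use loc in auto)
  have "holomorphic_into X \<A> \<Omega> \<Phi>"
    using S(3) \<Omega>(3) by (rule holomorphic_into_subset)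
  with J \<phi> \<Omega> ext show ?thesis
    unfolding conformal_open_arc_def by blast
qed

section \<open>Restricting a conformal map to the real interval\<close>

text \<open>In a local coordinate, \<open>z \<circ> \<Phi>\<close> is an injective holomorphic
  function of one variable. Its Taylor series at real points gives analyticity of
  \<open>\<phi>\<close>, and injectivity makes its derivative nonzero.\<close>

lemma conformal_imp_regular_analytic:
  assumes "conformal_open_arc X \<A> J"
  shows "regular_analytic_open_arc X \<A> J"
proof -
  obtain \<phi> \<Omega> \<Phi> where J: "open_arc X J" "arc_parametrization X J \<phi>"
    and \<Omega>: "open \<Omega>" "of_real ` unit_interval \<subseteq> \<Omega>" "holomorphic_into X \<A> \<Omega> \<Phi>" "inj_on \<Phi> \<Omega>"
    and ext: "\<And>t. t \<in> unit_interval \<Longrightarrow> \<Phi> (of_real t) = \<phi> t"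
    using assms unfolding conformal_open_arc_def by blast
  have local: "(\<exists>a :: nat \<Rightarrow> complex. \<forall>\<^sub>F x in nhds t.
        \<phi> x \<in> U \<and> (\<lambda>j. a j * of_real (x - t) ^ j) sums (z \<circ> \<phi>) x) \<and>
      (\<exists>D. ((z \<circ> \<phi>) has_vector_derivative D) (at t) \<and> D \<noteq> 0)"
    if t: "t \<in> unit_interval" and U: "local_coordinate X \<A> U z" "\<phi> t \<in> U" for t U z
  proof -
    have ch: "complex_chart X U z"
      using U by (simp add: local_coordinate_def)
    \<comment> \<open>This is the open part of \<open>\<Omega>\<close> on which the values of
      \<open>z \<circ> \<Phi>\<close> are meaningful.\<close>
    define S where "S = {s \<in> \<Omega>. \<Phi> s \<in> U}"
    have S: "open S"
      unfolding S_def using \<Omega>(1,3) ch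
      by (intro continuous_map_open_preimage) (auto simp: holomorphic_into_def complex_chart_def)
    have tS: "of_real t \<in> S"
      using t \<Omega>(2) ext U(2) by (auto simp: S_def)
    have hol: "(z \<circ> \<Phi>) holomorphic_on S"
      using \<Omega>(3) U(1) by (simp add: holomorphic_into_def S_def)
    have "inj_on (z \<circ> \<Phi>) S"
    proof (rule comp_inj_on)
      show "inj_on \<Phi> S"
        using \<Omega>(4) by (rule inj_on_subset) (auto simp: S_def)
      show "inj_on z (\<Phi> ` S)"
        using complex_chart_inj_on[OF ch] by (rule inj_on_subset) (auto simp: S_def)
    qed
    then have nz: "deriv (z \<circ> \<Phi>) (of_real t) \<noteq> 0"
      using holomorphic_injective_imp_regular[OF hol S] tS by blast
    obtain r where r: "r > 0" "ball (of_real t) r \<subseteq> S"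
      using S tS by (meson open_contains_ball)
    \<comment> \<open>The ball gives convergence of the Taylor series; the intersection with the
      unit interval gives \<open>\<Phi> (of_real x) = \<phi> x\<close>.\<close>
    define V where "V = ball t r \<inter> unit_interval"
    have V: "open V" "t \<in> V"
      using r(1) t by (auto simp: V_def unit_interval_def)
    have VS: "of_real x \<in> ball (of_real t :: complex) r" "of_real x \<in> S" "\<Phi> (of_real x) = \<phi> x"
      if "x \<in> V" for x
      using that r(2) ext by (auto simp: V_def subset_iff)
    have sums: "\<phi> x \<in> U \<and>
        (\<lambda>j. (deriv ^^ j) (z \<circ> \<Phi>) (of_real t) / fact j * of_real (x - t) ^ j) sums (z \<circ> \<phi>) x"
      if x: "x \<in> V" for x
      using holomorphic_power_series[OF holomorphic_on_subset[OF hol r(2)] VS(1)[OF x]] VS[OF x]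
      by (auto simp: S_def)
    have "\<forall>\<^sub>F x in nhds t. \<phi> x \<in> U \<and>
        (\<lambda>j. (deriv ^^ j) (z \<circ> \<Phi>) (of_real t) / fact j * of_real (x - t) ^ j) sums (z \<circ> \<phi>) x"
      using eventually_nhds_in_open[OF V] by (rule eventually_mono) (rule sums)
    moreover have "((\<lambda>x. (z \<circ> \<Phi>) (of_real x)) has_vector_derivative deriv (z \<circ> \<Phi>) (of_real t)) (at t)"
      by (intro has_vector_derivative_real_field holomorphic_derivI[OF hol S tS])
    then have "((z \<circ> \<phi>) has_vector_derivative deriv (z \<circ> \<Phi>) (of_real t)) (at t)"
      by (rule has_vector_derivative_transform_within_open[OF _ V]) (simp add: VS)
    ultimately show ?thesis
      using nz by (intro conjI exI[of _ "\<lambda>j. (deriv ^^ j) (z \<circ> \<Phi>) (of_real t) / fact j"]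
          exI[of _ "deriv (z \<circ> \<Phi>) (of_real t)"]) simp_all
  qed
  then show ?thesis
    using J unfolding regular_analytic_open_arc_def analytic_param_def nonvanishing_derivative_def
    by blast
qed

theorem corollary2:
  fixes X :: "'a topology"
    and \<A> :: "('a set \<times> ('a \<Rightarrow> complex)) set"
    and J :: "'a set"
  assumes "riemann_surface X \<A>"
    and "open_arc X J"
  shows "regular_analytic_open_arc X \<A> J \<longleftrightarrow> conformal_open_arc X \<A> J"
  using regular_analytic_imp_conformal[OF assms(1)] conformal_imp_regular_analytic by blast

end
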